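(* Let $M=(\Omega,P)$ be a Markov chain with countable state space $\Omega$ and transition kernel $P$, and let $(X_n)_{n\geq 0}$ be a trajectory of $M$ started at some state $x\in\Omega$. Suppose there exists a decreasing bijection $\Phi:[0,\infty)\to(0,1]$ such that \[ \int_0^1 \frac{1}{u\,(1\vee \log \Phi^{-1}(u))}\,\mathrm{d}u=\infty \qquad\text{and}\qquad \limsup_{n\to\infty}\frac{\mathbb{G}(X_n,X_m)}{\Phi(n)}<\infty \ \text{ almost surely, for every } m\geq 0, \] where $\Phi^{-1}$ denotes the inverse function of $\Phi$. Then $(X_n)_{n\geq0}$ has infinitely many cut times almost surely. In particular, the same conclusion holds if, almost surely, for each fixed $m\geq 0$ the sequence $(\mathbb{G}(X_n,X_m))_{n\geq 0}$ decays at least polynomially as $n\to\infty$.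
   Context: The Green's function is $\mathbb{G}(x,y)=\sum_{n\geq 0}P^n(x,y)$, the expected number of visits to $y$ of the chain started at $x$. A cut time of a sequence $(x_n)_{n\geq 0}$ is an integer $n\geq 0$ such that the sets $\{x_i:i\leq n\}$ and $\{x_i:i>n\}$ are disjoint. A sequence of non-negative numbers $(a_n)$ decays at least polynomially if there exist $c>0$ and $N$ such that $a_n\leq n^{-c}$ for all $n\geq N$. *)

theory Defs
  imports "HOL-Probability.Probability"
begin

definition stochastic_kernel :: "('a \<Rightarrow> 'a \<Rightarrow> real) \<Rightarrow> bool" where
  "stochastic_kernel P \<longleftrightarrow> (\<forall>x y. 0 \<le> P x y) \<and> (\<forall>x. (P x has_sum 1) UNIV)"

fun kpow :: "('a \<Rightarrow> 'a \<Rightarrow> real) \<Rightarrow> nat \<Rightarrow> 'a \<Rightarrow> 'a \<Rightarrow> ennreal" where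
  "kpow P 0 x y = (if x = y then 1 else 0)"
| "kpow P (Suc n) x y = (\<integral>\<^sup>+ z. ennreal (P x z) * kpow P n z y \<partial>count_space UNIV)"

definition green :: "('a \<Rightarrow> 'a \<Rightarrow> real) \<Rightarrow> 'a \<Rightarrow> 'a \<Rightarrow> ennreal" where
  "green P x y = (\<Sum>n. kpow P n x y)"

definition markov_trajectory ::
  "'w measure \<Rightarrow> ('a \<Rightarrow> 'a \<Rightarrow> real) \<Rightarrow> 'a \<Rightarrow> (nat \<Rightarrow> 'w \<Rightarrow> 'a) \<Rightarrow> bool" where
  "markov_trajectory M P x X \<longleftrightarrow>
     prob_space M \<and> (\<forall>n. X n \<in> M \<rightarrow>\<^sub>M count_space UNIV) \<and>
     (\<forall>n xs. measure M {w \<in> space M. \<forall>i\<le>n. X i w = xs i} =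
        (if xs 0 = x then (\<Prod>i<n. P (xs i) (xs (Suc i))) else 0))"

definition cut_time :: "(nat \<Rightarrow> 'a) \<Rightarrow> nat \<Rightarrow> bool" where
  "cut_time xs n \<longleftrightarrow> {xs i | i. i \<le> n} \<inter> {xs i | i. i > n} = {}"

definition decays_polynomially :: "(nat \<Rightarrow> ennreal) \<Rightarrow> bool" where
  "decays_polynomially a \<longleftrightarrow>
     (\<exists>c::real>0. \<exists>N. \<forall>n\<ge>N. a n \<le> ennreal (real n powr (-c)))"

end

theory Submission
  imports Defs
begin

text \<open>For a state \<open>y\<close> and \<open>C > 0\<close> the function \<open>f = min (G(\<cdot>, y) / C) 1\<close> is superharmonic, and \<open>n\<close> is a
  cut time as soon as all later values of \<open>f(X)\<close> lie below all values up to time \<open>n\<close>. Call each time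
  at which no previous attempt is still running the start of an attempt: the attempt started at \<open>n\<close>
  fails when \<open>f(X)\<close> returns to \<open>b = min {f(X\<^sub>i) | i \<le> n}\<close>. By the maximal inequality for
  nonnegative supermartingales, an attempt reaches a level \<open>u < b\<close> and then fails with probability at most
  \<open>u / (b - u)\<close> times the probability that it succeeds, and the successful attempts are disjoint.
  Let \<open>w(u) = 1 / max 1 (log (\<Phi>\<^sup>-\<^sup>1 u))\<close>. Since \<open>b \<le> \<Phi>(n)\<close>, \<open>w \<le> 1 / log n\<close> below \<open>b\<close>; integrating
  against \<open>w(u) / u\<close> and cutting off at \<open>b (1 - 1 / n\<^sup>2)\<close>, the failed attempts contribute a finite
  expected mass. If no attempt succeeded, every small level \<open>u\<close> would be reached by a failed attempt,
  and the mass would be infinite.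

  If \<open>f\<close> vanishes somewhere on the trajectory for every \<open>y = X\<^sub>m\<close>, the trajectory keeps leaving
  communicating classes for good, which yields cut times directly.\<close>

section \<open>Two integrals over levels\<close>

lemma nn_integral_inverse_gap:
  fixes b d L :: real
  assumes "0 < b" "0 < d" "d < 1" "0 \<le> L"
  shows "(\<integral>\<^sup>+u. ennreal (L / (b - u)) * indicator {0..b * (1 - d)} u \<partial>lborel) = ennreal (L * ln (1 / d))"
proof -
  have pos: "0 < b - u" if "u \<le> b * (1 - d)" for u
  proof -
    have "b * (1 - d) = b - b * d" by (simp add: algebra_simps)
    moreover have "0 < b * d" using assms by simp
    ultimately show ?thesis using that by linarith
  qed
  have "(\<integral>\<^sup>+u. ennreal (L / (b - u)) * indicator {0..b * (1 - d)} u \<partial>lborel)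
      = ennreal (- L * ln (b - b * (1 - d)) - - L * ln (b - 0))"
  proof (rule nn_integral_FTC_Icc)
    fix u assume "u \<in> {0..b * (1 - d)}"
    then have "0 < b - u" by (intro pos) simp
    then show "DERIV (\<lambda>u. - L * ln (b - u)) u :> L / (b - u)" "0 \<le> L / (b - u)"
      using assms by (auto intro!: derivative_eq_intros)
  qed (use assms in auto)
  also have "- L * ln (b - b * (1 - d)) - - L * ln (b - 0) = L * ln (1 / d)"
    using assms by (simp add: algebra_simps ln_mult ln_div)
  finally show ?thesis .
qed

text \<open>The bound \<open>w u \<le> 1\<close> makes the integral over levels between
  \<open>e\<close> and 1 at most 1 / \<open>e\<close>, so the divergence sits at 0. Levels above any
  fixed \<open>e\<close> may therefore be ignored.\<close>

lemma nn_integral_near_0: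
  fixes w :: "real \<Rightarrow> real"
  assumes [measurable]: "w \<in> borel_measurable borel"
    and w: "\<And>u. w u \<le> 1" and "0 < e"
    and inf: "(\<integral>\<^sup>+u. ennreal (w u / u) * indicator {0<..1} u \<partial>lborel) = \<infinity>"
  shows "(\<integral>\<^sup>+u. ennreal (w u / u) * indicator {0<..<e} u \<partial>lborel) = \<infinity>"
proof (rule ccontr)
  assume fin: "(\<integral>\<^sup>+u. ennreal (w u / u) * indicator {0<..<e} u \<partial>lborel) \<noteq> \<infinity>"
  have "(\<integral>\<^sup>+u. ennreal (w u / u) * indicator {0<..1} u \<partial>lborel)
    \<le> (\<integral>\<^sup>+u. ennreal (w u / u) * indicator {0<..<e} u + ennreal (1 / e) * indicator {0..1} u \<partial>lborel)"
  proof (rule nn_integral_mono)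
    fix u :: real
    consider "u \<le> 0 \<or> 1 < u" | "0 < u" "u < e" | "e \<le> u" "0 < u" "u \<le> 1" by linarith
    then show "ennreal (w u / u) * indicator {0<..1} u
        \<le> ennreal (w u / u) * indicator {0<..<e} u + ennreal (1 / e) * indicator {0..1} u"
    proof cases
      case 3
      then have "w u / u \<le> 1 / e" using w[of u] \<open>0 < e\<close> by (intro frac_le) auto
      then show ?thesis using 3 by (auto intro: ennreal_leI)
    qed (auto split: split_indicator)
  qed
  also have "\<dots> = (\<integral>\<^sup>+u. ennreal (w u / u) * indicator {0<..<e} u \<partial>lborel) + ennreal (1 / e)"
    by (subst nn_integral_add) (auto simp: nn_integral_cmult)
  also have "\<dots> < \<infinity>" using fin by (simp add: less_top)
  finally show False using inf by simp
qed

section \<open>Cylinder events of the trajectory\<close>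

locale markov_chain =
  fixes M :: "'w measure" and P :: "'a::countable \<Rightarrow> 'a \<Rightarrow> real"
    and x :: 'a and X :: "nat \<Rightarrow> 'w \<Rightarrow> 'a"
  assumes kernel: "stochastic_kernel P"
    and trajectory: "markov_trajectory M P x X"
begin

sublocale prob_space M
  using trajectory by (simp add: markov_trajectory_def)

lemma measurable_X [measurable]: "X n \<in> M \<rightarrow>\<^sub>M count_space UNIV"
  using trajectory by (simp add: markov_trajectory_def)

text \<open>A list records the states at times 0 up to \<open>length q - 1\<close>, so
  \<open>last q\<close> is the state at time \<open>length q - 1\<close>. Lists over a countable
  type are countable, which allows sums and almost sure statements over all prefixes.\<close>

definition cylinder :: "'a list \<Rightarrow> 'w set" where
  "cylinder q = {w \<in> space M. \<forall>i<length q. X i w = q ! i}"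

lemma cylinder_sets [measurable]: "cylinder q \<in> sets M"
  unfolding cylinder_def by measurable

lemma P_nonneg [simp]: "0 \<le> P y z"
  using kernel by (simp add: stochastic_kernel_def)

text \<open>The Markov property in the form used from here on: the product formula for the law gains
  one factor, and both sides vanish if the prefix does not start at \<open>x\<close>.\<close>

lemma emeasure_cylinder_snoc:
  assumes "q \<noteq> []"
  shows "emeasure M (cylinder (q @ [y])) = ennreal (P (last q) y) * emeasure M (cylinder q)"
proof -
  obtain n where n: "length q = Suc n"
    using assms by (cases q) auto
  have cyl: "measure M {w \<in> space M. \<forall>i\<le>m. X i w = xs i} =
      (if xs 0 = x then (\<Prod>i<m. P (xs i) (xs (Suc i))) else 0)" for m xs
    using trajectory by (simp add: markov_trajectory_def)
  have 1: "cylinder q = {w \<in> space M. \<forall>i\<le>n. X i w = q ! i}"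
    using n by (auto simp: cylinder_def less_Suc_eq_le)
  have 2: "cylinder (q @ [y]) = {w \<in> space M. \<forall>i\<le>Suc n. X i w = (q @ [y]) ! i}"
    using n by (auto simp: cylinder_def less_Suc_eq_le)
  have "(\<Prod>i<n. P ((q @ [y]) ! i) ((q @ [y]) ! Suc i)) = (\<Prod>i<n. P (q ! i) (q ! Suc i))"
    using n by (intro prod.cong) (auto simp: nth_append)
  then have "measure M (cylinder (q @ [y])) = P (last q) y * measure M (cylinder q)"
    unfolding 1 2 cyl using n assms by (auto simp: nth_append last_conv_nth)
  then show ?thesis
    by (simp add: emeasure_eq_measure ennreal_mult)
qed

lemma cylinder_Collect_sets:
  assumes [measurable]: "Measurable.pred M Q"
  shows "{w \<in> cylinder q. Q w} \<in> sets M"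
proof -
  have "{w \<in> cylinder q. Q w} = cylinder q \<inter> {w \<in> space M. Q w}"
    by (auto simp: cylinder_def)
  also have "\<dots> \<in> sets M"
    by (rule sets.Int) measurable
  finally show ?thesis .
qed

lemma cylinder_snoc: "w \<in> cylinder (q @ [y]) \<longleftrightarrow> w \<in> cylinder q \<and> X (length q) w = y"
proof -
  have "(\<forall>i<length (q @ [y]). X i w = (q @ [y]) ! i) \<longleftrightarrow>
      (\<forall>i<length q. X i w = q ! i) \<and> X (length q) w = y"
    by (simp add: All_less_Suc nth_append conj_commute)
  then show ?thesis
    unfolding cylinder_def by blast
qed

lemma cylinder_snoc_Un: "cylinder q = (\<Union>y. cylinder (q @ [y]))"
  by (simp add: set_eq_iff cylinder_snoc)

lemma disjoint_cylinder_snoc: "disjoint_family (\<lambda>y. cylinder (q @ [y]))"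
  unfolding disjoint_family_on_def set_eq_iff Int_iff cylinder_snoc by blast

lemma cylinder_prefix: "w \<in> space M \<Longrightarrow> w \<in> cylinder (map (\<lambda>i. X i w) [0..<n])"
  by (auto simp: cylinder_def)

lemma cylinder_iff: "w \<in> cylinder q \<longleftrightarrow> w \<in> space M \<and> q = map (\<lambda>i. X i w) [0..<length q]"
  unfolding cylinder_def list_eq_iff_nth_eq by auto

text \<open>A cylinder whose last transition has probability 0 is null, and there are only countably
  many cylinders.\<close>

lemma AE_positive_step: "AE w in M. \<forall>n. 0 < P (X n w) (X (Suc n) w)"
proof -
  have "AE w in M. \<forall>q y. q \<noteq> [] \<and> P (last q) y = 0 \<longrightarrow> w \<notin> cylinder (q @ [y])"
    unfolding AE_all_countable
  proof (intro allI)
    fix q y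
    show "AE w in M. q \<noteq> [] \<and> P (last q) y = 0 \<longrightarrow> w \<notin> cylinder (q @ [y])"
    proof (cases "q \<noteq> [] \<and> P (last q) y = 0")
      case True
      then have "cylinder (q @ [y]) \<in> null_sets M"
        using emeasure_cylinder_snoc[of q y] by (auto simp: null_sets_def)
      from AE_not_in[OF this] show ?thesis by auto
    next
      case False
      then show ?thesis by (intro AE_I2) blast
    qed
  qed
  then show ?thesis
  proof (rule AE_mp, intro AE_I2 impI allI)
    fix w n
    assume w: "w \<in> space M"
      and H: "\<forall>q y. q \<noteq> [] \<and> P (last q) y = 0 \<longrightarrow> w \<notin> cylinder (q @ [y])"
    have "w \<in> cylinder (map (\<lambda>i. X i w) [0..<Suc n] @ [X (Suc n) w])"
      using cylinder_prefix[OF w, of "Suc (Suc n)"] by simp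
    moreover have "last (map (\<lambda>i. X i w) [0..<Suc n]) = X n w" "map (\<lambda>i. X i w) [0..<Suc n] \<noteq> []"
      by auto
    ultimately have "P (X n w) (X (Suc n) w) \<noteq> 0"
      using H by metis
    then show "0 < P (X n w) (X (Suc n) w)"
      by (simp add: order_less_le)
  qed
qed

end

section \<open>The maximal inequality for a superharmonic function\<close>

locale superharmonic_chain = markov_chain M P x X
  for M :: "'w measure" and P :: "'a::countable \<Rightarrow> 'a \<Rightarrow> real" and x X +
  fixes f :: "'a \<Rightarrow> real"
  assumes f_nonneg [simp]: "0 \<le> f y"
    and superharmonic: "(\<integral>\<^sup>+ z. ennreal (P y z) * ennreal (f z) \<partial>count_space UNIV) \<le> ennreal (f y)"
begin

lemma measurable_f_X [measurable]: "(\<lambda>w. f (X n w)) \<in> borel_measurable M"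
  by measurable

text \<open>Induction on \<open>N\<close> with \<open>q\<close> arbitrary takes the place of
  optional stopping: the next state \<open>y\<close> splits \<open>cylinder q\<close> into the
  cylinders of \<open>q @ [y]\<close>, and \<open>superharmonic\<close> sums the bounds
  \<open>f y / b\<close> back to \<open>f (last q) / b\<close>. Once \<open>f (last q)\<close>
  reaches \<open>b\<close>, the factor is at least 1 and the bound is trivial.\<close>

lemma finite_horizon_maximal:
  assumes "q \<noteq> []" "0 < b"
  shows "emeasure M {w \<in> cylinder q. \<exists>k\<ge>length q - 1. k < length q + N \<and> b \<le> f (X k w)}
    \<le> ennreal (f (last q) / b) * emeasure M (cylinder q)"
  using assms
proof (induction N arbitrary: q)
  case (0 q)
  show ?case
  proof (cases "b \<le> f (last q)")
    case True
    then have "1 \<le> ennreal (f (last q) / b)"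
      using 0 by (simp add: ennreal_ge_1)
    have "emeasure M {w \<in> cylinder q. \<exists>k\<ge>length q - 1. k < length q + 0 \<and> b \<le> f (X k w)}
      \<le> 1 * emeasure M (cylinder q)"
      by (auto intro!: emeasure_mono)
    also have "\<dots> \<le> ennreal (f (last q) / b) * emeasure M (cylinder q)"
      by (intro mult_right_mono) (fact, simp)
    finally show ?thesis .
  next
    case False
    have "X k w = last q" if "w \<in> cylinder q" "length q - 1 \<le> k" "k < length q" for k w
    proof -
      have "k = length q - 1" using that by auto
      then show ?thesis using that 0 by (auto simp: cylinder_def last_conv_nth)
    qed
    then have eq: "{w \<in> cylinder q. \<exists>k\<ge>length q - 1. k < length q + 0 \<and> b \<le> f (X k w)} = {}"
      using False by auto
    show ?thesis by (subst eq) simp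
  qed
next
  case (Suc N q)
  show ?case
  proof (cases "b \<le> f (last q)")
    case True
    then have "1 \<le> ennreal (f (last q) / b)"
      using Suc.prems by (simp add: ennreal_ge_1)
    have "emeasure M {w \<in> cylinder q. \<exists>k\<ge>length q - 1. k < length q + Suc N \<and> b \<le> f (X k w)}
      \<le> 1 * emeasure M (cylinder q)"
      by (auto intro!: emeasure_mono)
    also have "\<dots> \<le> ennreal (f (last q) / b) * emeasure M (cylinder q)"
      by (intro mult_right_mono) (fact, simp)
    finally show ?thesis .
  next
    case False
    \<comment> \<open>The last state lies below \<open>b\<close>, so time
      \<open>length q - 1\<close> cannot contribute, and the remaining window is the one that
      belongs to \<open>q @ [y]\<close> with horizon \<open>N\<close>.\<close>
    let ?A = "\<lambda>y. {w \<in> cylinder (q @ [y]). \<exists>k\<ge>length q. k < Suc (length q + N) \<and> b \<le> f (X k w)}"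
    have le_k: "length q \<le> k"
      if "w \<in> cylinder q" "length q - 1 \<le> k" "b \<le> f (X k w)" for k w
    proof (rule ccontr)
      assume "\<not> length q \<le> k"
      with that Suc.prems have "k = length q - 1" "k < length q" by auto
      then have "X k w = last q" using that Suc.prems by (auto simp: cylinder_def last_conv_nth)
      with that False show False by simp
    qed
    have "{w \<in> cylinder q. \<exists>k\<ge>length q - 1. k < length q + Suc N \<and> b \<le> f (X k w)}
        = {w \<in> cylinder q. \<exists>k\<ge>length q. k < Suc (length q + N) \<and> b \<le> f (X k w)}"
    proof (rule Collect_cong, rule conj_cong, rule refl, rule ex_cong1)
      fix w k assume "w \<in> cylinder q"
      then show "length q - 1 \<le> k \<and> k < length q + Suc N \<and> b \<le> f (X k w) \<longleftrightarrow>
          length q \<le> k \<and> k < Suc (length q + N) \<and> b \<le> f (X k w)"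
        using le_k[of w k] by linarith
    qed
    also have "\<dots> = (\<Union>y. ?A y)"
      unfolding cylinder_snoc_Un[of q] by blast
    finally have "emeasure M {w \<in> cylinder q. \<exists>k\<ge>length q - 1. k < length q + Suc N \<and> b \<le> f (X k w)}
        = emeasure M (\<Union>y. ?A y)"
      by (rule arg_cong)
    also have "\<dots> = (\<integral>\<^sup>+ y. emeasure M (?A y) \<partial>count_space UNIV)"
    proof (rule emeasure_UN_countable)
      show "disjoint_family ?A"
        by (rule disjoint_family_on_bisimulation[OF disjoint_cylinder_snoc]) auto
    qed (auto intro!: cylinder_Collect_sets)
    also have "\<dots> \<le> (\<integral>\<^sup>+ y. ennreal (f y / b) * emeasure M (cylinder (q @ [y])) \<partial>count_space UNIV)"
    proof (rule nn_integral_mono)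
      fix y
      show "emeasure M (?A y) \<le> ennreal (f y / b) * emeasure M (cylinder (q @ [y]))"
        using Suc.IH[of "q @ [y]"] Suc.prems by simp
    qed
    also have "\<dots> = (\<integral>\<^sup>+ y. (ennreal (1 / b) * emeasure M (cylinder q)) *
        (ennreal (P (last q) y) * ennreal (f y)) \<partial>count_space UNIV)"
      using Suc.prems
      by (intro nn_integral_cong)
         (simp add: emeasure_cylinder_snoc divide_inverse ennreal_mult mult_ac)
    also have "\<dots> \<le> (ennreal (1 / b) * emeasure M (cylinder q)) * ennreal (f (last q))"
      by (subst nn_integral_cmult) (auto intro!: mult_left_mono superharmonic)
    also have "\<dots> = ennreal (f (last q) / b) * emeasure M (cylinder q)"
      using Suc.prems by (simp add: divide_inverse ennreal_mult mult_ac)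
    finally show ?thesis .
  qed
qed

lemma maximal_inequality:
  assumes "q \<noteq> []" "0 < b"
  shows "emeasure M {w \<in> cylinder q. \<exists>k\<ge>length q. b \<le> f (X k w)}
    \<le> ennreal (f (last q) / b) * emeasure M (cylinder q)"
proof -
  define A where "A N = {w \<in> cylinder q. \<exists>k\<ge>length q - 1. k < length q + N \<and> b \<le> f (X k w)}" for N
  have [measurable]: "A N \<in> sets M" for N
    unfolding A_def by (rule cylinder_Collect_sets) measurable
  have "emeasure M {w \<in> cylinder q. \<exists>k\<ge>length q. b \<le> f (X k w)} \<le> emeasure M (\<Union>N. A N)"
  proof (rule emeasure_mono)
    show "{w \<in> cylinder q. \<exists>k\<ge>length q. b \<le> f (X k w)} \<subseteq> (\<Union>N. A N)"
    proof
      fix w assume "w \<in> {w \<in> cylinder q. \<exists>k\<ge>length q. b \<le> f (X k w)}"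
      then obtain k where "w \<in> cylinder q" "length q \<le> k" "b \<le> f (X k w)" by blast
      moreover have "k < length q + Suc k" "length q - 1 \<le> k"
        using \<open>length q \<le> k\<close> by simp_all
      ultimately have "w \<in> A (Suc k)" unfolding A_def by blast
      then show "w \<in> (\<Union>N. A N)" by blast
    qed
  qed auto
  also have "\<dots> = (SUP N. emeasure M (A N))"
  proof (rule SUP_emeasure_incseq[symmetric])
    show "incseq A"
      by (rule incseq_SucI) (auto simp: A_def)
  qed auto
  also have "\<dots> \<le> ennreal (f (last q) / b) * emeasure M (cylinder q)"
    unfolding A_def by (rule SUP_least) (rule finite_horizon_maximal[OF assms])
  finally show ?thesis .
qed

section \<open>Returning after a descent\<close>

definition stays_below :: "'a list \<Rightarrow> real \<Rightarrow> 'w set" where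
  "stays_below p b = {w \<in> cylinder p. \<forall>j\<ge>length p. f (X j w) < b}"

text \<open>The attempt started at the end of \<open>p\<close> is still running when level
  \<open>u\<close> is reached; it may succeed or fail later.\<close>

definition descends :: "'a list \<Rightarrow> real \<Rightarrow> real \<Rightarrow> 'w set" where
  "descends p b u = {w \<in> cylinder p. \<exists>j\<ge>length p. f (X j w) \<le> u \<and>
     (\<forall>i. length p \<le> i \<and> i < j \<longrightarrow> f (X i w) < b)}"

lemma stays_below_sets [measurable]: "stays_below p b \<in> sets M"
  unfolding stays_below_def by (rule cylinder_Collect_sets) measurable

lemma descends_sets [measurable]: "descends p b u \<in> sets M"
  unfolding descends_def by (rule cylinder_Collect_sets) measurable

lemma cylinder_nth: "w \<in> cylinder q \<Longrightarrow> i < length q \<Longrightarrow> q ! i = X i w"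
  by (simp add: cylinder_def)

text \<open>At the first visit to a level at most \<open>u\<close>, the maximal inequality bounds
  the chance of a return to \<open>b\<close> by \<open>u / b\<close>. Writing D for the descent and
  S for the success, this gives P(D - S) \<le> (u / b) P(D), and P(D) \<le> P(D - S) + P(S) turns it
  into a bound by P(S).\<close>

lemma return_bound:
  assumes "p \<noteq> []" "0 < u" "u < b"
  shows "emeasure M (descends p b u - stays_below p b)
    \<le> ennreal (u / (b - u)) * emeasure M (stays_below p b)"
proof -
  \<comment> \<open>Extensions of \<open>p\<close> that stop exactly at the first value at most
    \<open>u\<close>, with all values in between below \<open>b\<close>. Their cylinders partition
    the descent event.\<close>
  define Q where "Q = {q. length p < length q \<and> take (length p) q = p \<and> f (last q) \<le> u \<and>
    (\<forall>i. length p \<le> i \<and> Suc i < length q \<longrightarrow> u < f (q ! i) \<and> f (q ! i) < b)}"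
  define R where "R q = {w \<in> cylinder q. \<exists>k\<ge>length q. b \<le> f (X k w)}" for q
  have last_Q: "last q = X (length q - 1) w" if "q \<in> Q" "w \<in> cylinder q" for q w
  proof -
    have "q \<noteq> []" using that by (auto simp: Q_def)
    then show ?thesis using cylinder_nth[OF that(2), of "length q - 1"] by (simp add: last_conv_nth)
  qed
  have [measurable]: "R q \<in> sets M" for q
    unfolding R_def by (rule cylinder_Collect_sets) measurable
  \<comment> \<open>Of two such prefixes of one trajectory, the shorter would end at a value at most
    \<open>u\<close>, where the longer one still requires a value above \<open>u\<close>.\<close>
  have not_shorter: "\<not> length q < length q'"
    if "q \<in> Q" "q' \<in> Q" "w \<in> cylinder q" "w \<in> cylinder q'" for q q' w
  proof
    assume l: "length q < length q'"
    have "length p \<le> length q - 1 \<and> Suc (length q - 1) < length q'"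
      using that(1) l by (auto simp: Q_def)
    then have "u < f (q' ! (length q - 1))"
      using that(2) unfolding Q_def by blast
    moreover have "q' ! (length q - 1) = last q"
      using last_Q[OF that(1,3)] cylinder_nth[OF that(4), of "length q - 1"] l by simp
    moreover have "f (last q) \<le> u" using that(1) by (simp add: Q_def)
    ultimately show False by simp
  qed
  have disj: "disjoint_family_on cylinder Q"
  proof (unfold disjoint_family_on_def, intro ballI impI equals0I)
    fix q q' w assume *: "q \<in> Q" "q' \<in> Q" "q \<noteq> q'" "w \<in> cylinder q \<inter> cylinder q'"
    then have "length q = length q'"
      using not_shorter[of q q' w] not_shorter[of q' q w] by auto
    then show False using *(3,4) by (metis IntD1 IntD2 cylinder_iff)
  qed
  have disjR: "disjoint_family_on R Q"
    using disj unfolding R_def disjoint_family_on_def by fast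
  have desc_eq: "descends p b u = (\<Union>q\<in>Q. cylinder q)"
  proof (intro equalityI subsetI)
    fix w assume "w \<in> descends p b u"
    then obtain j where w: "w \<in> cylinder p" and j: "length p \<le> j" "f (X j w) \<le> u"
      "\<And>i. length p \<le> i \<Longrightarrow> i < j \<Longrightarrow> f (X i w) < b"
      by (auto simp: descends_def)
    define k where "k = (LEAST k. length p \<le> k \<and> f (X k w) \<le> u)"
    have k: "length p \<le> k" "f (X k w) \<le> u"
      using LeastI[of "\<lambda>k. length p \<le> k \<and> f (X k w) \<le> u" j] j by (auto simp: k_def)
    have "k \<le> j" unfolding k_def using j by (intro Least_le) simp
    have above: "u < f (X i w)" if "length p \<le> i" "i < k" for i
      using not_less_Least[of i "\<lambda>k. length p \<le> k \<and> f (X k w) \<le> u"] that by (auto simp: k_def)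
    define q where "q = map (\<lambda>i. X i w) [0..<Suc k]"
    have "take (length p) q = p"
      using w k by (auto simp: q_def list_eq_iff_nth_eq cylinder_def simp del: upt_Suc)
    moreover have "last q = X k w" "length q = Suc k" by (auto simp: q_def)
    moreover have "u < f (q ! i) \<and> f (q ! i) < b" if "length p \<le> i" "Suc i < length q" for i
      using that above[of i] j(3)[of i] \<open>k \<le> j\<close> by (auto simp: q_def simp del: upt_Suc)
    ultimately have "q \<in> Q" using k by (auto simp: Q_def)
    moreover have "w \<in> cylinder q"
      unfolding q_def using w by (intro cylinder_prefix) (simp add: cylinder_def)
    ultimately show "w \<in> (\<Union>q\<in>Q. cylinder q)" by blast
  next
    fix w assume "w \<in> (\<Union>q\<in>Q. cylinder q)"
    then obtain q where q: "q \<in> Q" "w \<in> cylinder q" by blast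
    have len: "length p < length q" and "take (length p) q = p" using q by (auto simp: Q_def)
    have "X i w = p ! i" if "i < length p" for i
    proof -
      have "p ! i = q ! i" using \<open>take (length p) q = p\<close> that by (metis nth_take)
      then show ?thesis using cylinder_nth[OF q(2), of i] that len by simp
    qed
    then have "w \<in> cylinder p" using q(2) by (simp add: cylinder_def)
    moreover have "f (X (length q - 1) w) \<le> u"
      using last_Q[OF q] q(1) by (simp add: Q_def)
    moreover have "f (X i w) < b" if "length p \<le> i" "i < length q - 1" for i
    proof -
      have "f (q ! i) < b" using q(1) that by (simp add: Q_def)
      then show ?thesis using cylinder_nth[OF q(2), of i] that by simp
    qed
    moreover have "length p \<le> length q - 1" using len by simp
    ultimately show "w \<in> descends p b u" unfolding descends_def by blast
  qed
  have "descends p b u - stays_below p b \<subseteq> (\<Union>q\<in>Q. R q)"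
  proof
    fix w assume w: "w \<in> descends p b u - stays_below p b"
    then obtain q where q: "q \<in> Q" "w \<in> cylinder q" unfolding desc_eq by blast
    from w obtain k where k: "length p \<le> k" "b \<le> f (X k w)"
      by (auto simp: descends_def stays_below_def not_less)
    have "length q \<le> k"
    proof (rule ccontr)
      assume "\<not> length q \<le> k"
      then consider "k = length q - 1" | "Suc k < length q" by linarith
      then show False
      proof cases
        case 1
        then have "f (X k w) \<le> u" using last_Q[OF q] q(1) by (simp add: Q_def)
        then show False using k assms by simp
      next
        case 2
        then have "f (q ! k) < b" using q(1) k by (simp add: Q_def)
        then show False using cylinder_nth[OF q(2), of k] 2 k by simp
      qed
    qed
    then show "w \<in> (\<Union>q\<in>Q. R q)" using q k by (auto simp: R_def)
  qed
  then have "emeasure M (descends p b u - stays_below p b) \<le> emeasure M (\<Union>q\<in>Q. R q)"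
    by (rule emeasure_mono) auto
  also have "\<dots> = (\<integral>\<^sup>+q. emeasure M (R q) \<partial>count_space Q)"
    by (rule emeasure_UN_countable[OF _ _ disjR]) auto
  also have "\<dots> \<le> (\<integral>\<^sup>+q. ennreal (u / b) * emeasure M (cylinder q) \<partial>count_space Q)"
  proof (rule nn_integral_mono)
    fix q assume "q \<in> space (count_space Q)"
    then have "q \<noteq> []" "f (last q) \<le> u" by (auto simp: Q_def)
    then have "ennreal (f (last q) / b) \<le> ennreal (u / b)"
      using assms by (intro ennreal_leI divide_right_mono) auto
    then show "emeasure M (R q) \<le> ennreal (u / b) * emeasure M (cylinder q)"
      unfolding R_def using assms
      by (intro order.trans[OF maximal_inequality[OF \<open>q \<noteq> []\<close>]] mult_right_mono) auto
  qed
  also have "\<dots> = ennreal (u / b) * emeasure M (descends p b u)"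
    unfolding desc_eq by (subst emeasure_UN_countable[OF _ _ disj]) (auto simp: nn_integral_cmult)
  finally have "emeasure M (descends p b u - stays_below p b)
    \<le> ennreal (u / b) * emeasure M (descends p b u)" .
  \<comment> \<open>Real probabilities permit the subtraction; the inequality is solved for the
    failure probability using \<open>u < b\<close>.\<close>
  then have "prob (descends p b u - stays_below p b) \<le> u / b * prob (descends p b u)"
    using assms by (simp add: emeasure_eq_measure flip: ennreal_mult)
  moreover have "prob (descends p b u) \<le> prob (descends p b u - stays_below p b) + prob (stays_below p b)"
    by (rule order.trans[OF finite_measure_mono measure_Un_le]) auto
  then have "u / b * prob (descends p b u)
      \<le> u / b * (prob (descends p b u - stays_below p b) + prob (stays_below p b))"
    using assms by (intro mult_left_mono) auto
  ultimately have "prob (descends p b u - stays_below p b)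
      \<le> u / b * (prob (descends p b u - stays_below p b) + prob (stays_below p b))"
    by linarith
  then have "prob (descends p b u - stays_below p b) \<le> u / (b - u) * prob (stays_below p b)"
    using assms by (simp add: field_simps)
  then show ?thesis
    using assms by (simp add: emeasure_eq_measure flip: ennreal_mult)
qed

text \<open>The factor \<open>u\<close> of \<open>return_bound\<close> cancels against
  \<open>w u / u\<close>, leaving \<open>L / (b - u)\<close>, which is not integrable up to
  \<open>b\<close>. In the window of relative width \<open>d\<close> below \<open>b\<close> the
  trivial bound by the cylinder is used instead.\<close>

lemma attempt_bound:
  fixes w :: "real \<Rightarrow> real" and b d L :: real
  assumes "p \<noteq> []" "0 < u" "u < b" "0 < d" "d < 1" "0 \<le> w u" "w u \<le> L"
  shows "emeasure M (descends p b u - stays_below p b) * ennreal (w u / u)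
    \<le> ennreal (L / (b - u)) * indicator {0..b * (1 - d)} u * emeasure M (stays_below p b)
      + ennreal (L / (b * (1 - d))) * indicator {b * (1 - d)..b} u * emeasure M (cylinder p)"
proof (cases "u < b * (1 - d)")
  case True
  have "emeasure M (descends p b u - stays_below p b) * ennreal (w u / u)
    \<le> (ennreal (u / (b - u)) * emeasure M (stays_below p b)) * ennreal (L / u)"
    using assms by (intro mult_mono return_bound ennreal_leI divide_right_mono) auto
  also have "\<dots> = ennreal (L / (b - u)) * emeasure M (stays_below p b)"
  proof -
    have "ennreal (u / (b - u)) * ennreal (L / u) = ennreal (L / (b - u))"
      using assms by (simp flip: ennreal_mult)
    then show ?thesis by (metis mult.assoc mult.commute)
  qed
  finally show ?thesis using True assms by simp
next
  case False
  have "0 < b * (1 - d)" using assms by simp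
  then have "w u / u \<le> L / (b * (1 - d))"
    using assms False by (intro frac_le) auto
  moreover have "emeasure M (descends p b u - stays_below p b) \<le> emeasure M (cylinder p)"
    by (rule emeasure_mono) (auto simp: descends_def)
  ultimately have "emeasure M (descends p b u - stays_below p b) * ennreal (w u / u)
      \<le> emeasure M (cylinder p) * ennreal (L / (b * (1 - d)))"
    by (intro mult_mono ennreal_leI) auto
  then show ?thesis using False assms by (simp add: mult.commute add_increasing)
qed

section \<open>Fresh prefixes: disjoint successes and counting\<close>

definition level :: "'a list \<Rightarrow> real" where
  "level p = Min (f ` set p)"

lemma level_le: "i < length p \<Longrightarrow> level p \<le> f (p ! i)"
  unfolding level_def by (intro Min_le) auto

lemma less_level_iff: "p \<noteq> [] \<Longrightarrow> u < level p \<longleftrightarrow> (\<forall>i<length p. u < f (p ! i))"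
  unfolding level_def by (simp add: all_set_conv_all_nth)

text \<open>Prefixes at which a new attempt to stay below all previous values starts: every attempt
  started since time \<^term>\<open>m\<close> has failed by the end of the prefix.\<close>

definition fresh :: "(nat \<Rightarrow> real) \<Rightarrow> nat \<Rightarrow> 'a list set" where
  "fresh \<phi> m = {p. m < length p \<and> 0 < level p \<and> f (last p) \<le> \<phi> (length p - 1) \<and>
    (\<forall>k. m \<le> k \<and> Suc k < length p \<longrightarrow> (\<exists>j. k < j \<and> j < length p \<and> (\<exists>i\<le>k. f (p ! i) \<le> f (p ! j))))}"

text \<open>After a success no later prefix is fresh, since freshness would require the successful
  attempt to have failed already. Hence the success probabilities of all fresh prefixes sum to at
  most 1.\<close>

lemma disjoint_stays_below_fresh: "disjoint_family_on (\<lambda>p. stays_below p (level p)) (fresh \<phi> m)"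
proof -
  have not_shorter: "\<not> length p < length q"
    if "p \<in> fresh \<phi> m" "q \<in> fresh \<phi> m" "w \<in> stays_below p (level p)" "w \<in> cylinder q" for p q w
  proof
    assume l: "length p < length q"
    \<comment> \<open>The attempt of \<open>p\<close> starts at time \<open>length p - 1\<close>;
      freshness of the longer \<open>q\<close> is applied to this time.\<close>
    have "m \<le> length p - 1" "Suc (length p - 1) < length q"
      using that(1) l by (auto simp: fresh_def)
    with \<open>q \<in> fresh \<phi> m\<close> obtain i j where *: "length p - 1 < j" "j < length q" "i \<le> length p - 1" "f (q ! i) \<le> f (q ! j)"
      unfolding fresh_def by blast
    have w: "w \<in> cylinder p" using that by (simp add: stays_below_def)
    have i: "i < length p" using *(3) that(1) by (auto simp: fresh_def)
    have "f (X j w) < level p" using that(3) *(1) by (auto simp: stays_below_def)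
    also have "\<dots> \<le> f (X i w)" using level_le[OF i] cylinder_nth[OF w i] by simp
    finally show False
      using * i l cylinder_nth[OF that(4), of i] cylinder_nth[OF that(4), of j] by simp
  qed
  show ?thesis
  proof (unfold disjoint_family_on_def, intro ballI impI equals0I)
    fix p q w
    assume *: "p \<in> fresh \<phi> m" "q \<in> fresh \<phi> m" "p \<noteq> q"
      "w \<in> stays_below p (level p) \<inter> stays_below q (level q)"
    then have w: "w \<in> cylinder p" "w \<in> cylinder q" by (auto simp: stays_below_def)
    have "length p = length q"
      using not_shorter[of p q w] not_shorter[of q p w] * w by auto
    then show False using * w by (metis cylinder_iff)
  qed
qed

text \<open>Each trajectory has exactly one prefix of every length, so exchanging sum and
  expectation leaves one term per length.\<close>

lemma nn_integral_length_cylinder: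
  fixes g :: "nat \<Rightarrow> ennreal"
  shows "(\<integral>\<^sup>+p. g (length p) * emeasure M (cylinder p) \<partial>count_space UNIV) = (\<Sum>n. g n)"
proof -
  have "(\<integral>\<^sup>+p. g (length p) * emeasure M (cylinder p) \<partial>count_space UNIV)
      = (\<integral>\<^sup>+p. \<integral>\<^sup>+w. g (length p) * indicator (cylinder p) w \<partial>M \<partial>count_space UNIV)"
    by (intro nn_integral_cong) (simp add: nn_integral_cmult)
  also have "\<dots> = (\<integral>\<^sup>+w. \<integral>\<^sup>+p. g (length p) * indicator (cylinder p) w \<partial>count_space UNIV \<partial>M)"
    by (rule nn_integral_count_space_nn_integral[symmetric]) auto
  also have "\<dots> = (\<integral>\<^sup>+w. (\<Sum>n. g n) \<partial>M)"
  proof (rule nn_integral_cong)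
    fix w assume w: "w \<in> space M"
    define R where "R = range (\<lambda>n. map (\<lambda>i. X i w) [0..<n])"
    have "inj (\<lambda>n. map (\<lambda>i. X i w) [0..<n])"
      by (rule injI) (metis diff_zero length_map length_upt)
    then have bij: "bij_betw (\<lambda>n. map (\<lambda>i. X i w) [0..<n]) UNIV R"
      by (simp add: bij_betw_def R_def)
    have ind: "indicator (cylinder p) w = (indicator R p :: ennreal)" for p
      using w unfolding indicator_def R_def by (auto simp: cylinder_iff)
    have "(\<integral>\<^sup>+p. g (length p) * indicator (cylinder p) w \<partial>count_space UNIV)
        = (\<integral>\<^sup>+p. g (length p) * indicator R p \<partial>count_space UNIV)"
      by (simp only: ind)
    also have "\<dots> = (\<integral>\<^sup>+p. g (length p) \<partial>count_space R)"
      by (simp add: nn_integral_count_space_indicator)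
    also have "\<dots> = (\<integral>\<^sup>+n. g (length (map (\<lambda>i. X i w) [0..<n])) \<partial>count_space UNIV)"
      by (rule nn_integral_bij_count_space[OF bij, symmetric])
    also have "\<dots> = (\<Sum>n. g n)" by (simp add: nn_integral_count_space_nat)
    finally show "(\<integral>\<^sup>+p. g (length p) * indicator (cylinder p) w \<partial>count_space UNIV) = (\<Sum>n. g n)" .
  qed
  also have "\<dots> = (\<Sum>n. g n)" by (simp add: emeasure_space_1)
  finally show ?thesis .
qed

text \<open>Among the attempts still running at the first passage \<open>t\<close> below
  \<open>u\<close>, the earliest one starts at a fresh prefix. It has passed \<open>u\<close>, and
  it must fail later because no attempt from \<open>m\<close> on succeeds.\<close>

lemma descent_below_level:
  fixes a :: "nat \<Rightarrow> real"
  assumes a: "\<And>n. a n = f (X n w)" and w: "w \<in> space M"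
    and le: "\<And>n. m \<le> n \<Longrightarrow> a n \<le> \<phi> n" and pos: "\<And>n. 0 < a n" and lim: "\<phi> \<longlonglongrightarrow> 0"
    and no_record: "\<not> (\<exists>n\<ge>m. \<forall>j>n. \<forall>i\<le>n. a j < a i)"
    and u: "0 < u" "\<And>i. i \<le> m \<Longrightarrow> u < a i"
  shows "\<exists>p\<in>fresh \<phi> m. u < level p \<and> w \<in> descends p (level p) u - stays_below p (level p)"
proof -
  have "\<forall>\<^sub>F n in sequentially. \<phi> n < u \<and> m \<le> n"
    using order_tendstoD(2)[OF lim u(1)] eventually_ge_at_top[of m] by eventually_elim simp
  then obtain t0 where "\<phi> t0 < u" "m \<le> t0"
    by (metis (mono_tags, lifting) eventually_sequentially order_refl)
  then have t0: "a t0 \<le> u" using le[of t0] by simp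
  \<comment> \<open>All values up to time \<open>m\<close> exceed \<open>u\<close>, so this first
    passage comes after \<open>m\<close>, and an attempt started at \<open>t - 1\<close> is running
    at \<open>t\<close>.\<close>
  define t where "t = (LEAST t. a t \<le> u)"
  have t: "a t \<le> u" unfolding t_def using t0 by (rule LeastI)
  have above: "u < a i" if "i < t" for i
    using not_less_Least[of i "\<lambda>t. a t \<le> u"] that by (auto simp: t_def)
  have "m < t" using u(2)[of t] t by (metis leD not_less)
  define alive where "alive k s \<longleftrightarrow> (\<forall>j. k < j \<and> j \<le> s \<longrightarrow> (\<forall>i\<le>k. a j < a i))" for k s
  define n where "n = (LEAST k. m \<le> k \<and> k < t \<and> alive k t)"
  have "alive (t - 1) t"
    unfolding alive_def
  proof (intro allI impI)
    fix j i assume "t - 1 < j \<and> j \<le> t" "i \<le> t - 1"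
    then have "j = t" "i < t" using \<open>m < t\<close> by auto
    then show "a j < a i" using above[of i] t by simp
  qed
  then have n: "m \<le> n" "n < t" "alive n t"
    using LeastI[of "\<lambda>k. m \<le> k \<and> k < t \<and> alive k t" "t - 1"] \<open>m < t\<close> by (auto simp: n_def)
  \<comment> \<open>If the attempt of \<open>k\<close> were running at \<open>n\<close>, it would
    also be running at \<open>t\<close>, since the values in between lie below all values up to
    \<open>n\<close>. That contradicts the minimality of \<open>n\<close>.\<close>
  have dead: "\<not> alive k n" if "m \<le> k" "k < n" for k
  proof
    assume k: "alive k n"
    have "alive k t"
      unfolding alive_def
    proof (intro allI impI)
      fix j i assume *: "k < j \<and> j \<le> t" "i \<le> k"
      show "a j < a i"
      proof (cases "j \<le> n")
        case True
        then show ?thesis using k * unfolding alive_def by blast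
      next
        case False
        then show ?thesis using n(3) * that unfolding alive_def by auto
      qed
    qed
    then show False
      using not_less_Least[of k "\<lambda>k. m \<le> k \<and> k < t \<and> alive k t"] that n by (auto simp: n_def)
  qed
  define p where "p = map (\<lambda>i. X i w) [0..<Suc n]"
  have p: "length p = Suc n" "p \<noteq> []" "\<And>i. i \<le> n \<Longrightarrow> f (p ! i) = a i"
    by (auto simp: p_def a simp del: upt_Suc)
  have last_p: "last p = X n w" by (simp add: p_def)
  have lv: "y < level p \<longleftrightarrow> (\<forall>i\<le>n. y < a i)" for y
    using less_level_iff[OF p(2), of y] p(1,3) by (auto simp: less_Suc_eq_le)
  have "u < level p" unfolding lv using above n by auto
  have "\<exists>j. k < j \<and> j < length p \<and> (\<exists>i\<le>k. f (p ! i) \<le> f (p ! j))" if k: "m \<le> k" "Suc k < length p" for k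
  proof -
    have "k < n" using k p by simp
    with dead[of k] k obtain j i where "k < j" "j \<le> n" "i \<le> k" "\<not> a j < a i"
      unfolding alive_def by blast
    then show ?thesis using p(1) p(3)[of i] p(3)[of j] by (intro exI[of _ j]) auto
  qed
  then have "p \<in> fresh \<phi> m"
    using n p last_p \<open>u < level p\<close> u(1) le[of n] by (auto simp: fresh_def a)
  moreover have wp: "w \<in> cylinder p" unfolding p_def by (rule cylinder_prefix[OF w])
  moreover have "w \<in> descends p (level p) u"
  proof -
    have "f (X i w) < level p" if "length p \<le> i" "i < t" for i
      unfolding lv using n(3) that p(1) unfolding alive_def by (auto simp: a)
    moreover have "length p \<le> t" using n p by simp
    ultimately show ?thesis
      unfolding descends_def using wp t by (auto simp: a)
  qed
  moreover have "w \<notin> stays_below p (level p)"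
  proof
    assume "w \<in> stays_below p (level p)"
    then have "f (X j w) < level p" if "n < j" for j
      using that p(1) by (auto simp: stays_below_def)
    then have "\<forall>j>n. \<forall>i\<le>n. a j < a i" unfolding lv a by blast
    with no_record n show False by blast
  qed
  ultimately show ?thesis using \<open>u < level p\<close> by blast
qed

text \<open>The levels passed by failed attempts started from \<open>m\<close> on are integrated
  against \<open>w u / u\<close>. The expectation is finite, whereas a trajectory without a record
  passes every small level in this way and has infinite integral.\<close>

lemma AE_record_time:
  fixes w :: "real \<Rightarrow> real"
  assumes [measurable]: "w \<in> borel_measurable borel"
    and w: "\<And>u. 0 \<le> w u" "\<And>u. w u \<le> 1"
    and w_le: "\<And>n u. 0 < u \<Longrightarrow> u < \<phi> n \<Longrightarrow> w u \<le> 1 / max 1 (ln (real n))"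
    and lim: "\<phi> \<longlonglongrightarrow> 0"
    and inf: "(\<integral>\<^sup>+u. ennreal (w u / u) * indicator {0<..1} u \<partial>lborel) = \<infinity>"
    and m: "2 \<le> m"
  shows "AE \<omega> in M. (\<forall>n\<ge>m. f (X n \<omega>) \<le> \<phi> n) \<and> (\<forall>n. 0 < f (X n \<omega>)) \<longrightarrow>
    (\<exists>n\<ge>m. \<forall>j>n. \<forall>i\<le>n. f (X j \<omega>) < f (X i \<omega>))"
proof -
  let ?F = "fresh \<phi> m"
  define D where "D p u = descends p (level p) u - stays_below p (level p)" for p u
  define A where "A \<omega> u \<longleftrightarrow> (\<exists>p. p \<in> ?F \<and> 0 < u \<and> u < level p \<and> \<omega> \<in> D p u)" for \<omega> u
  \<comment> \<open>With \<open>descends\<close> unfolded, only countable quantifiers and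
    comparisons remain, so joint measurability in the trajectory and the level can be derived
    automatically.\<close>
  have A_iff: "A \<omega> u \<longleftrightarrow> (\<exists>p. p \<in> ?F \<and> 0 < u \<and> u < level p \<and> \<omega> \<in> cylinder p \<and>
      (\<exists>j\<ge>length p. f (X j \<omega>) \<le> u \<and> (\<forall>i. length p \<le> i \<and> i < j \<longrightarrow> f (X i \<omega>) < level p)) \<and>
      \<not> \<omega> \<in> stays_below p (level p))" for \<omega> u
    unfolding A_def D_def descends_def by blast
  have A_meas [measurable]: "Measurable.pred (M \<Otimes>\<^sub>M borel) (\<lambda>z. A (fst z) (snd z))"
    unfolding A_iff by measurable
  define H where "H \<omega> u = (if A \<omega> u then ennreal (w u / u) else 0)" for \<omega> u
  have H_meas [measurable]: "case_prod H \<in> borel_measurable (M \<Otimes>\<^sub>M borel)"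
    unfolding H_def case_prod_beta by measurable
  define L where "L p = 1 / max 1 (ln (real (length p - 1)))" for p :: "'a list"
  \<comment> \<open>With n = \<open>length p - 1\<close>, the cutoff 1 / n^2 gives
    \<open>ln (1 / d p)\<close> = 2 ln n, which the factor \<open>L p\<close> reduces to at most 2.
    The window next to the level costs at most \<open>g (length p)\<close> = 2 / n^2, which is
    summable. The assumption \<open>2 \<le> m\<close> keeps \<open>d p\<close> at most 1 /
    4.\<close>
  define d where "d p = 1 / (real (length p - 1))\<^sup>2" for p :: "'a list"
  define g where "g l = 2 / (real (l - 1))\<^sup>2" for l :: nat
  define G where "G p u = ennreal (L p / (level p - u)) * indicator {0..level p * (1 - d p)} u *
        emeasure M (stays_below p (level p))
      + ennreal (L p / (level p * (1 - d p))) * indicator {level p * (1 - d p)..level p} u *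
        emeasure M (cylinder p)" for p u
  have G_meas [measurable]: "G p \<in> borel_measurable borel" for p
    unfolding G_def by measurable
  have F: "0 < level p" "p \<noteq> []" "0 < d p" "d p \<le> 1 / 4" "0 \<le> L p" "L p \<le> 1"
    "L p * ln (1 / d p) \<le> 2" if "p \<in> ?F" for p
  proof -
    define n where "n = length p - 1"
    have n: "2 \<le> n" using that m by (auto simp: fresh_def n_def)
    have dn: "d p = 1 / (real n)\<^sup>2" by (simp add: d_def n_def)
    have Ln: "L p = 1 / max 1 (ln (real n))" by (simp add: L_def n_def)
    show "0 < level p" "p \<noteq> []" using that by (auto simp: fresh_def)
    show "0 < d p" using n by (simp add: dn)
    have "2\<^sup>2 \<le> (real n)\<^sup>2" using n by (intro power_mono) auto
    then show "d p \<le> 1 / 4" using n by (simp add: dn field_simps)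
    show "0 \<le> L p" "L p \<le> 1" by (auto simp: L_def)
    have "ln (1 / d p) = 2 * ln (real n)"
      using n by (simp add: dn ln_realpow)
    moreover have "L p * (2 * ln (real n)) \<le> 2"
      unfolding Ln by (simp add: divide_simps)
    ultimately show "L p * ln (1 / d p) \<le> 2" by simp
  qed
  have slice: "(\<integral>\<^sup>+\<omega>. H \<omega> u \<partial>M) \<le> (\<integral>\<^sup>+p. G p u \<partial>count_space ?F)" for u
  proof -
    have "(\<integral>\<^sup>+\<omega>. H \<omega> u \<partial>M) \<le> (\<integral>\<^sup>+\<omega>. \<integral>\<^sup>+p. ennreal (w u / u) * indicator {0<..<level p} u *
        indicator (D p u) \<omega> \<partial>count_space ?F \<partial>M)"
    proof (rule nn_integral_mono)
      fix \<omega>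
      let ?h = "\<lambda>p. ennreal (w u / u) * indicator {0<..<level p} u * indicator (D p u) \<omega>"
      show "H \<omega> u \<le> (\<integral>\<^sup>+p. ?h p \<partial>count_space ?F)"
      proof (cases "A \<omega> u")
        case True
        then obtain p where "p \<in> ?F" "0 < u" "u < level p" "\<omega> \<in> D p u" by (auto simp: A_def)
        then show ?thesis
          using nn_integral_ge_point[of p ?F ?h] True by (simp add: H_def)
      qed (simp add: H_def)
    qed
    also have "\<dots> = (\<integral>\<^sup>+p. \<integral>\<^sup>+\<omega>. ennreal (w u / u) * indicator {0<..<level p} u *
        indicator (D p u) \<omega> \<partial>M \<partial>count_space ?F)"
      by (rule nn_integral_count_space_nn_integral) (auto simp: D_def)
    also have "\<dots> \<le> (\<integral>\<^sup>+p. G p u \<partial>count_space ?F)"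
    proof (rule nn_integral_mono)
      fix p assume "p \<in> space (count_space ?F)"
      then have p: "p \<in> ?F" by simp
      have eq: "(\<integral>\<^sup>+\<omega>. ennreal (w u / u) * indicator {0<..<level p} u * indicator (D p u) \<omega> \<partial>M)
          = emeasure M (D p u) * ennreal (w u / u) * indicator {0<..<level p} u"
        by (subst nn_integral_cmult) (auto simp: D_def mult_ac)
      show "(\<integral>\<^sup>+\<omega>. ennreal (w u / u) * indicator {0<..<level p} u * indicator (D p u) \<omega> \<partial>M) \<le> G p u"
      proof (cases "u \<in> {0<..<level p}")
        case True
        \<comment> \<open>The decay enters here: the level lies below \<open>\<phi>\<close> at the
          starting time, so \<open>w_le\<close> bounds \<open>w u\<close> by
          \<open>L p\<close>.\<close>
        have "level p \<le> f (last p)"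
          using level_le[of "length p - 1" p] F(2)[OF p] by (simp add: last_conv_nth)
        also have "\<dots> \<le> \<phi> (length p - 1)" using p by (simp add: fresh_def)
        finally have "w u \<le> L p" unfolding L_def using True by (intro w_le) auto
        then have "emeasure M (D p u) * ennreal (w u / u) \<le> G p u"
          unfolding G_def D_def using True F[OF p] w by (intro attempt_bound) auto
        then show ?thesis unfolding eq using True by simp
      qed (simp add: eq)
    qed
    finally show ?thesis .
  qed
  have "(\<integral>\<^sup>+\<omega>. \<integral>\<^sup>+u. H \<omega> u \<partial>lborel \<partial>M) = (\<integral>\<^sup>+u. \<integral>\<^sup>+\<omega>. H \<omega> u \<partial>M \<partial>lborel)"
  proof -
    interpret pair_sigma_finite M lborel ..
    show ?thesis by (rule Fubini'[symmetric]) measurable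
  qed
  also have "\<dots> \<le> (\<integral>\<^sup>+u. \<integral>\<^sup>+p. G p u \<partial>count_space ?F \<partial>lborel)"
    by (rule nn_integral_mono) (rule slice)
  also have "\<dots> = (\<integral>\<^sup>+p. \<integral>\<^sup>+u. G p u \<partial>lborel \<partial>count_space ?F)"
    by (rule nn_integral_count_space_nn_integral) auto
  also have "\<dots> \<le> (\<integral>\<^sup>+p. 2 * emeasure M (stays_below p (level p)) +
      ennreal (g (length p)) * emeasure M (cylinder p) \<partial>count_space ?F)"
  proof (rule nn_integral_mono)
    fix p assume "p \<in> space (count_space ?F)"
    then have p: "p \<in> ?F" by simp
    note Fp = F[OF p]
    have "(\<integral>\<^sup>+u. G p u \<partial>lborel) =
        (\<integral>\<^sup>+u. ennreal (L p / (level p - u)) * indicator {0..level p * (1 - d p)} u \<partial>lborel) *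
          emeasure M (stays_below p (level p))
        + (\<integral>\<^sup>+u. ennreal (L p / (level p * (1 - d p))) * indicator {level p * (1 - d p)..level p} u \<partial>lborel) *
          emeasure M (cylinder p)"
      unfolding G_def by (subst nn_integral_add) (auto simp: nn_integral_multc)
    also have "(\<integral>\<^sup>+u. ennreal (L p / (level p - u)) * indicator {0..level p * (1 - d p)} u \<partial>lborel)
        = ennreal (L p * ln (1 / d p))"
      using Fp by (intro nn_integral_inverse_gap) auto
    also have "(\<integral>\<^sup>+u. ennreal (L p / (level p * (1 - d p))) * indicator {level p * (1 - d p)..level p} u \<partial>lborel)
        = ennreal (L p * d p / (1 - d p))"
    proof -
      have "level p * (1 - d p) \<le> level p * 1" using Fp by (intro mult_left_mono) auto
      then have "(\<integral>\<^sup>+u. ennreal (L p / (level p * (1 - d p))) * indicator {level p * (1 - d p)..level p} u \<partial>lborel)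
          = ennreal (L p / (level p * (1 - d p))) * ennreal (level p - level p * (1 - d p))"
        by (subst nn_integral_cmult_indicator) auto
      also have "\<dots> = ennreal (L p / (level p * (1 - d p)) * (level p - level p * (1 - d p)))"
        using Fp by (intro ennreal_mult'[symmetric]) auto
      also have "L p / (level p * (1 - d p)) * (level p - level p * (1 - d p)) = L p * d p / (1 - d p)"
        using Fp by (simp add: field_simps)
      finally show ?thesis .
    qed
    also have "ennreal (L p * ln (1 / d p)) * emeasure M (stays_below p (level p))
        + ennreal (L p * d p / (1 - d p)) * emeasure M (cylinder p)
      \<le> 2 * emeasure M (stays_below p (level p)) + ennreal (g (length p)) * emeasure M (cylinder p)"
    proof (intro add_mono mult_right_mono)
      show "ennreal (L p * ln (1 / d p)) \<le> 2"
        using Fp(7) by (metis ennreal_leI ennreal_numeral)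
      have "L p * d p / (1 - d p) \<le> 1 * d p / (1 / 2)"
        using Fp by (intro frac_le mult_right_mono) auto
      also have "\<dots> = g (length p)" by (simp add: g_def d_def)
      finally show "ennreal (L p * d p / (1 - d p)) \<le> ennreal (g (length p))" by (rule ennreal_leI)
    qed auto
    finally show "(\<integral>\<^sup>+u. G p u \<partial>lborel) \<le> 2 * emeasure M (stays_below p (level p)) +
      ennreal (g (length p)) * emeasure M (cylinder p)" .
  qed
  also have "\<dots> = 2 * (\<integral>\<^sup>+p. emeasure M (stays_below p (level p)) \<partial>count_space ?F)
      + (\<integral>\<^sup>+p. ennreal (g (length p)) * emeasure M (cylinder p) \<partial>count_space ?F)"
    by (subst nn_integral_add) (auto simp: nn_integral_cmult)
  also have "\<dots> \<le> 2 * 1 + (\<Sum>n. ennreal (g n))"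
  proof (intro add_mono mult_left_mono)
    have "(\<integral>\<^sup>+p. emeasure M (stays_below p (level p)) \<partial>count_space ?F)
        = emeasure M (\<Union>p\<in>?F. stays_below p (level p))"
      by (rule emeasure_UN_countable[OF _ _ disjoint_stays_below_fresh, symmetric]) auto
    then show "(\<integral>\<^sup>+p. emeasure M (stays_below p (level p)) \<partial>count_space ?F) \<le> 1"
      by (simp add: emeasure_le_1)
    have "(\<integral>\<^sup>+p. ennreal (g (length p)) * emeasure M (cylinder p) \<partial>count_space ?F)
        = (\<integral>\<^sup>+p. ennreal (g (length p)) * emeasure M (cylinder p) * indicator ?F p \<partial>count_space UNIV)"
      by (simp add: nn_integral_count_space_indicator)
    also have "\<dots> \<le> (\<integral>\<^sup>+p. ennreal (g (length p)) * emeasure M (cylinder p) \<partial>count_space UNIV)"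
      by (intro nn_integral_mono) (auto split: split_indicator)
    finally show "(\<integral>\<^sup>+p. ennreal (g (length p)) * emeasure M (cylinder p) \<partial>count_space ?F)
        \<le> (\<Sum>n. ennreal (g n))"
      by (simp only: nn_integral_length_cylinder[of "\<lambda>n. ennreal (g n)"])
  qed auto
  also have "\<dots> < \<infinity>"
  proof -
    \<comment> \<open>The shift by one matches \<open>length p - 1\<close>; the term at n = 0 is 0
      because division by zero gives 0.\<close>
    have "summable (\<lambda>n. 2 * inverse ((real n)\<^sup>2))"
      by (intro summable_mult inverse_power_summable) auto
    then have "summable (\<lambda>n. g (Suc n))" by (simp add: g_def divide_inverse)
    then have "summable g" by (simp only: summable_Suc_iff)
    moreover have "0 \<le> g n" for n by (simp add: g_def)
    ultimately have "(\<Sum>n. ennreal (g n)) \<noteq> \<infinity>"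
      unfolding infinity_ennreal_def by (rule ennreal_suminf_neq_top)
    then show ?thesis by (simp add: less_top)
  qed
  finally have "(\<integral>\<^sup>+\<omega>. \<integral>\<^sup>+u. H \<omega> u \<partial>lborel \<partial>M) \<noteq> \<infinity>" by simp
  then have "AE \<omega> in M. (\<integral>\<^sup>+u. H \<omega> u \<partial>lborel) \<noteq> \<infinity>"
    by (rule nn_integral_PInf_AE[rotated]) measurable
  then show ?thesis
  proof (rule AE_mp, intro AE_I2 impI)
    fix \<omega> assume \<omega>: "\<omega> \<in> space M" and fin: "(\<integral>\<^sup>+u. H \<omega> u \<partial>lborel) \<noteq> \<infinity>"
      and ev: "(\<forall>n\<ge>m. f (X n \<omega>) \<le> \<phi> n) \<and> (\<forall>n. 0 < f (X n \<omega>))"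
    show "\<exists>n\<ge>m. \<forall>j>n. \<forall>i\<le>n. f (X j \<omega>) < f (X i \<omega>)"
    proof (rule ccontr)
      assume no: "\<not> (\<exists>n\<ge>m. \<forall>j>n. \<forall>i\<le>n. f (X j \<omega>) < f (X i \<omega>))"
      \<comment> \<open>Levels below the minimum over times up to \<open>m\<close> are first passed
        after \<open>m\<close>, as \<open>descent_below_level\<close> requires.\<close>
      define e where "e = Min ((\<lambda>i. f (X i \<omega>)) ` {..m})"
      have "0 < e" unfolding e_def using ev by (subst Min_gr_iff) auto
      have e_le: "e \<le> f (X i \<omega>)" if "i \<le> m" for i
        unfolding e_def using that by (intro Min_le) auto
      have "A \<omega> u" if "0 < u" "u < e" for u
      proof -
        have "\<exists>p\<in>?F. u < level p \<and> \<omega> \<in> descends p (level p) u - stays_below p (level p)"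
        proof (rule descent_below_level[OF refl \<omega> _ _ lim no that(1)])
          show "u < f (X i \<omega>)" if "i \<le> m" for i
            using e_le[OF that] \<open>u < e\<close> by simp
        qed (use ev in auto)
        then show ?thesis unfolding A_def D_def using that(1) by blast
      qed
      then have "(\<integral>\<^sup>+u. ennreal (w u / u) * indicator {0<..<e} u \<partial>lborel) \<le> (\<integral>\<^sup>+u. H \<omega> u \<partial>lborel)"
        by (intro nn_integral_mono) (auto simp: H_def split: split_indicator)
      then show False
        using nn_integral_near_0[OF _ w(2) \<open>0 < e\<close> inf] fin by (simp add: top_unique)
    qed
  qed
qed

end

section \<open>The Green's function along the trajectory\<close>

context markov_chain
begin

lemma kpow_Suc_suminf:
  "(\<Sum>n. kpow P (Suc n) z y) = (\<integral>\<^sup>+z'. ennreal (P z z') * green P z' y \<partial>count_space UNIV)"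
  unfolding kpow.simps green_def
  by (subst nn_integral_suminf[symmetric]) (auto simp: ennreal_suminf_cmult)

lemma green_unfold:
  "green P z y = (if z = y then 1 else 0)
    + (\<integral>\<^sup>+z'. ennreal (P z z') * green P z' y \<partial>count_space UNIV)"
proof -
  have "green P z y = kpow P 0 z y + (\<Sum>n. kpow P (Suc n) z y)"
    unfolding green_def
    using suminf_offset[of "\<lambda>n. kpow P n z y" 1] by simp
  then show ?thesis unfolding kpow_Suc_suminf by simp
qed

lemma green_self_nonzero: "green P y y \<noteq> 0"
  by (subst green_unfold) simp

text \<open>A nonzero value means that \<open>y\<close> can be reached, and this passes backwards
  along steps of positive probability.\<close>

lemma green_step_nonzero:
  assumes "0 < P z z'" "green P z' y \<noteq> 0"
  shows "green P z y \<noteq> 0"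
proof -
  have "0 < ennreal (P z z') * green P z' y"
    using assms by (simp add: ennreal_zero_less_mult_iff zero_less_iff_neq_zero)
  also have "\<dots> \<le> (\<integral>\<^sup>+z'. ennreal (P z z') * green P z' y \<partial>count_space UNIV)"
    by (rule nn_integral_ge_point) simp
  also have "\<dots> \<le> green P z y" by (subst (2) green_unfold) simp
  finally show ?thesis by simp
qed

lemma nn_integral_P: "(\<integral>\<^sup>+z'. ennreal (P z z') \<partial>count_space UNIV) = 1"
proof -
  have "(P z has_sum 1) UNIV" using kernel by (simp add: stochastic_kernel_def)
  then have s: "(\<Sum>\<^sub>\<infinity>z'. P z z') = 1" "P z summable_on UNIV"
    by (auto simp: infsumI has_sum_imp_summable)
  then have "(\<lambda>z'. norm (P z z')) summable_on UNIV" by simp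
  then have abs: "Infinite_Set_Sum.abs_summable_on (P z) UNIV"
    by (simp only: abs_summable_equivalent)
  show ?thesis
    using nn_integral_conv_infsetsum[OF abs] infsetsum_infsum[OF abs] s by simp
qed

text \<open>A minimum of superharmonic functions: the first by \<open>green_unfold\<close>, the
  constant 1 because rows of \<open>P\<close> sum to 1. Truncation keeps the function real where the
  Green's function is infinite, and \<open>C\<close> absorbs the constant of the decay
  bound.\<close>

lemma superharmonic_truncated_green:
  fixes C :: real
  assumes "0 < C"
  shows "superharmonic_chain M P x X (\<lambda>z. enn2real (min (green P z y / ennreal C) 1))"
proof (unfold_locales)
  fix z
  have fin: "ennreal (enn2real (min (green P z y / ennreal C) 1)) = min (green P z y / ennreal C) 1" for z
    by (rule ennreal_enn2real) (simp add: min_less_iff_disj)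
  show "0 \<le> enn2real (min (green P z y / ennreal C) 1)" by simp
  have "(\<integral>\<^sup>+z'. ennreal (P z z') * min (green P z' y / ennreal C) 1 \<partial>count_space UNIV)
      \<le> (\<integral>\<^sup>+z'. ennreal (P z z') * green P z' y / ennreal C \<partial>count_space UNIV)"
    by (intro nn_integral_mono) (simp add: ennreal_times_divide[symmetric] mult_left_mono)
  also have "\<dots> = (\<integral>\<^sup>+z'. ennreal (P z z') * green P z' y \<partial>count_space UNIV) / ennreal C"
    by (rule nn_integral_divide) simp
  also have "\<dots> \<le> green P z y / ennreal C"
    by (intro divide_right_mono_ennreal) (subst (2) green_unfold, simp)
  finally have 1: "(\<integral>\<^sup>+z'. ennreal (P z z') * min (green P z' y / ennreal C) 1 \<partial>count_space UNIV)
      \<le> green P z y / ennreal C" .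
  have "(\<integral>\<^sup>+z'. ennreal (P z z') * min (green P z' y / ennreal C) 1 \<partial>count_space UNIV)
      \<le> (\<integral>\<^sup>+z'. ennreal (P z z') * 1 \<partial>count_space UNIV)"
    by (intro nn_integral_mono mult_left_mono) auto
  also have "\<dots> = 1" by (simp add: nn_integral_P)
  finally show "(\<integral>\<^sup>+z'. ennreal (P z z') * ennreal (enn2real (min (green P z' y / ennreal C) 1))
      \<partial>count_space UNIV) \<le> ennreal (enn2real (min (green P z y / ennreal C) 1))"
    unfolding fin using 1 by simp
qed

text \<open>Let \<open>k\<close> be the last time from which \<open>s m\<close> can be reached.
  Every state up to \<open>k\<close> can reach \<open>s m\<close> and no later state can, so
  \<open>k\<close> is a cut time; \<open>m \<le> k\<close> because \<open>s m\<close> reaches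
  itself.\<close>

lemma infinite_cut_times_if_escaping:
  assumes step: "\<And>n. 0 < P (s n) (s (Suc n))"
    and escape: "\<And>m. \<exists>n. green P (s n) (s m) = 0"
  shows "infinite {n. cut_time s n}"
  unfolding infinite_nat_iff_unbounded_le
proof
  fix m
  have reach: "green P (s i) (s m) \<noteq> 0" if "i \<le> j" "green P (s j) (s m) \<noteq> 0" for i j
    using that(1)
  proof (induction rule: inc_induct)
    case base
    show ?case by (rule that(2))
  next
    case (step n)
    show ?case by (rule green_step_nonzero[OF assms(1) step.IH])
  qed
  obtain n0 where n0: "green P (s n0) (s m) = 0" using escape by blast
  define n where "n = (LEAST n. green P (s n) (s m) = 0)"
  have n: "green P (s n) (s m) = 0" unfolding n_def using n0 by (rule LeastI)
  have "m < n"
    using reach[of n m] n green_self_nonzero by (metis not_less)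
  then obtain k where k: "n = Suc k" "m \<le> k" by (cases n) auto
  have "green P (s k) (s m) \<noteq> 0"
    using not_less_Least[of k "\<lambda>n. green P (s n) (s m) = 0"] k by (simp add: n_def)
  have "s i \<noteq> s j" if "i \<le> k" "k < j" for i j
  proof
    assume "s i = s j"
    then have "green P (s j) (s m) \<noteq> 0"
      using reach[OF that(1) \<open>green P (s k) (s m) \<noteq> 0\<close>] by simp
    then show False using reach[of n j] that k n by simp
  qed
  then have "cut_time s k" unfolding cut_time_def by blast
  then show "\<exists>n\<ge>m. n \<in> {n. cut_time s n}" using k by blast
qed

text \<open>A time after which the truncated Green's function stays strictly below all earlier
  values separates past from future states. The target \<open>y\<close> is deterministic here, as
  \<open>AE_record_time\<close> needs a fixed function.\<close>

lemma AE_infinite_cut_times_if_reachable: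
  fixes w :: "real \<Rightarrow> real"
  assumes w: "w \<in> borel_measurable borel" "\<And>u. 0 \<le> w u" "\<And>u. w u \<le> 1"
    "\<And>n u. 0 < u \<Longrightarrow> u < \<phi> n \<Longrightarrow> w u \<le> 1 / max 1 (ln (real n))"
    and lim: "\<phi> \<longlonglongrightarrow> 0" and \<phi>: "\<And>n. 0 \<le> \<phi> n"
    and inf: "(\<integral>\<^sup>+u. ennreal (w u / u) * indicator {0<..1} u \<partial>lborel) = \<infinity>"
  shows "AE \<omega> in M. (\<exists>C m. \<forall>n\<ge>m. green P (X n \<omega>) y \<le> ennreal (real (Suc C) * \<phi> n)) \<and>
    (\<forall>n. green P (X n \<omega>) y \<noteq> 0) \<longrightarrow> infinite {n. cut_time (\<lambda>i. X i \<omega>) n}"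
proof -
  define f where "f C z = enn2real (min (green P z y / ennreal (real (Suc C))) 1)" for C z
  have "AE \<omega> in M. (\<forall>n\<ge>m. f C (X n \<omega>) \<le> \<phi> n) \<and> (\<forall>n. 0 < f C (X n \<omega>)) \<longrightarrow>
      (\<exists>n\<ge>m. \<forall>j>n. \<forall>i\<le>n. f C (X j \<omega>) < f C (X i \<omega>))" if "2 \<le> m" for m C
  proof -
    interpret superharmonic_chain M P x X "f C"
      unfolding f_def by (rule superharmonic_truncated_green) simp
    show ?thesis by (rule AE_record_time[OF w lim inf that])
  qed
  \<comment> \<open>The constant and the starting time depend on the trajectory, so the null sets
    for all natural \<open>C\<close> and \<open>m\<close> are combined.\<close>
  then have "AE \<omega> in M. \<forall>C m. 2 \<le> m \<longrightarrow> (\<forall>n\<ge>m. f C (X n \<omega>) \<le> \<phi> n) \<and> (\<forall>n. 0 < f C (X n \<omega>)) \<longrightarrow>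
      (\<exists>n\<ge>m. \<forall>j>n. \<forall>i\<le>n. f C (X j \<omega>) < f C (X i \<omega>))"
    unfolding AE_all_countable by (auto intro: AE_I2)
  then show ?thesis
  proof (rule AE_mp, intro AE_I2 impI)
    fix \<omega>
    assume rec: "\<forall>C m. 2 \<le> m \<longrightarrow> (\<forall>n\<ge>m. f C (X n \<omega>) \<le> \<phi> n) \<and> (\<forall>n. 0 < f C (X n \<omega>)) \<longrightarrow>
        (\<exists>n\<ge>m. \<forall>j>n. \<forall>i\<le>n. f C (X j \<omega>) < f C (X i \<omega>))"
      and H: "(\<exists>C m. \<forall>n\<ge>m. green P (X n \<omega>) y \<le> ennreal (real (Suc C) * \<phi> n)) \<and>
        (\<forall>n. green P (X n \<omega>) y \<noteq> 0)"
    then obtain C m0 where C: "\<And>n. m0 \<le> n \<Longrightarrow> green P (X n \<omega>) y \<le> ennreal (real (Suc C) * \<phi> n)"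
      by blast
    have pos: "0 < f C (X n \<omega>)" for n
    proof -
      have "green P (X n \<omega>) y / ennreal (real (Suc C)) \<noteq> 0"
        using H by (simp add: ennreal_divide_eq_0_iff del: of_nat_Suc)
      then have "0 < min (green P (X n \<omega>) y / ennreal (real (Suc C))) 1"
        unfolding min_less_iff_conj by (simp add: zero_less_iff_neq_zero del: of_nat_Suc)
      moreover have "min (green P (X n \<omega>) y / ennreal (real (Suc C))) 1 < top"
        by (simp add: min_less_iff_disj)
      ultimately show ?thesis unfolding f_def enn2real_positive_iff by blast
    qed
    have le: "f C (X n \<omega>) \<le> \<phi> n" if "m0 \<le> n" for n
    proof -
      have "green P (X n \<omega>) y / ennreal (real (Suc C)) \<le> ennreal (real (Suc C) * \<phi> n) / ennreal (real (Suc C))"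
        using C[OF that] by (rule divide_right_mono_ennreal)
      also have "\<dots> = ennreal (\<phi> n)" using \<phi>[of n] by (subst divide_ennreal) auto
      finally have "min (green P (X n \<omega>) y / ennreal (real (Suc C))) 1 \<le> ennreal (\<phi> n)"
        by (rule min.coboundedI1)
      then show ?thesis unfolding f_def using \<phi>[of n] by (intro enn2real_leI)
    qed
    show "infinite {n. cut_time (\<lambda>i. X i \<omega>) n}"
      unfolding infinite_nat_iff_unbounded_le
    proof
      fix N
      have "(\<forall>n\<ge>max 2 (max m0 N). f C (X n \<omega>) \<le> \<phi> n) \<and> (\<forall>n. 0 < f C (X n \<omega>))"
        using le pos by simp
      with rec obtain n where n: "max 2 (max m0 N) \<le> n" "\<forall>j>n. \<forall>i\<le>n. f C (X j \<omega>) < f C (X i \<omega>)"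
        by (meson max.cobounded1)
      have "X i \<omega> \<noteq> X j \<omega>" if "i \<le> n" "n < j" for i j
        using n(2) that by force
      then have "cut_time (\<lambda>i. X i \<omega>) n" unfolding cut_time_def by blast
      then show "\<exists>n\<ge>N. n \<in> {n. cut_time (\<lambda>i. X i \<omega>) n}" using n by auto
    qed
  qed
qed

text \<open>The countable index \<open>k\<close> lets the decay profile depend on the trajectory and
  on \<open>m\<close>. Only a bound linking \<open>w k\<close> to \<open>\<phi> k\<close> is
  required, so powers of n qualify although they do not come from a bijection onto (0, 1].\<close>

lemma AE_infinite_cut_times:
  fixes w :: "nat \<Rightarrow> real \<Rightarrow> real"
  assumes w: "\<And>k. w k \<in> borel_measurable borel" "\<And>k u. 0 \<le> w k u" "\<And>k u. w k u \<le> 1"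
    "\<And>k n u. 0 < u \<Longrightarrow> u < \<phi> k n \<Longrightarrow> w k u \<le> 1 / max 1 (ln (real n))"
    and lim: "\<And>k. \<phi> k \<longlonglongrightarrow> 0" and \<phi>: "\<And>k n. 0 \<le> \<phi> k n"
    and inf: "\<And>k. (\<integral>\<^sup>+u. ennreal (w k u / u) * indicator {0<..1} u \<partial>lborel) = \<infinity>"
    and decay: "AE \<omega> in M. \<forall>m. \<exists>k C n0. \<forall>n\<ge>n0. green P (X n \<omega>) (X m \<omega>) \<le> ennreal (real (Suc C) * \<phi> k n)"
  shows "AE \<omega> in M. infinite {n. cut_time (\<lambda>i. X i \<omega>) n}"
proof -
  have "AE \<omega> in M. \<forall>k y. (\<exists>C m. \<forall>n\<ge>m. green P (X n \<omega>) y \<le> ennreal (real (Suc C) * \<phi> k n)) \<and>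
      (\<forall>n. green P (X n \<omega>) y \<noteq> 0) \<longrightarrow> infinite {n. cut_time (\<lambda>i. X i \<omega>) n}"
    unfolding AE_all_countable
    by (intro allI AE_infinite_cut_times_if_reachable[OF w lim \<phi> inf])
  with decay AE_positive_step show ?thesis
  proof eventually_elim
    case (elim \<omega>)
    \<comment> \<open>Either every \<open>X m\<close> eventually becomes unreachable, or some
      \<open>X m\<close> stays reachable forever and serves as the target \<open>y\<close>.\<close>
    show ?case
    proof (cases "\<forall>m. \<exists>n. green P (X n \<omega>) (X m \<omega>) = 0")
      case True
      then show ?thesis using elim(2) by (intro infinite_cut_times_if_escaping) auto
    next
      case False
      then show ?thesis using elim(1,3) by metis
    qed
  qed
qed

end

section \<open>Profiles with divergent integral\<close>

lemma nn_integral_inverse_log: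
  fixes K :: real
  assumes "1 \<le> K"
  shows "(\<integral>\<^sup>+u. ennreal (1 / max 1 (- K * ln u) / u) * indicator {0<..1} u \<partial>lborel) = \<infinity>"
    (is "?I = _")
proof -
  have ge: "of_nat n \<le> ?I" for n
  proof -
    \<comment> \<open>The antiderivative is - ln (- ln u) / \<open>K\<close>, and this lower
      endpoint makes the integral up to exp (-1) equal to n exactly. On that range -
      \<open>K\<close> ln u is at least 1, so the maximum is inactive.\<close>
    define a where "a = exp (- exp (K * real n))"
    have "0 < a" by (simp add: a_def)
    have a_le: "a \<le> exp (- 1)" using assms by (simp add: a_def)
    have ln_le: "ln u \<le> - 1" "0 < u" if "u \<in> {a..exp (- 1)}" for u
    proof -
      show "0 < u" using that \<open>0 < a\<close> by auto
      then show "ln u \<le> - 1" using that by (metis atLeastAtMost_iff ln_exp ln_le_cancel_iff exp_gt_zero)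
    qed
    have "of_nat n = ennreal (- ln (- ln (exp (- 1))) / K - - ln (- ln a) / K)"
      using assms by (simp add: a_def ennreal_of_nat_eq_real_of_nat)
    also have "\<dots> = (\<integral>\<^sup>+u. ennreal (1 / (- K * ln u) / u) * indicator {a..exp (- 1)} u \<partial>lborel)"
    proof (rule nn_integral_FTC_Icc[symmetric])
      fix u assume u: "u \<in> {a..exp (- 1)}"
      note * = ln_le[OF u]
      have "u < 1" using * by (simp flip: ln_less_zero_iff)
      show "DERIV (\<lambda>u. - ln (- ln u) / K) u :> 1 / (- K * ln u) / u"
        using * \<open>u < 1\<close> assms by (auto intro!: derivative_eq_intros simp: field_simps)
      show "0 \<le> 1 / (- K * ln u) / u"
        using * \<open>u < 1\<close> assms by (auto simp: zero_le_divide_iff mult_le_0_iff)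
    qed (use a_le in auto)
    also have "\<dots> \<le> ?I"
    proof (rule nn_integral_mono)
      fix u :: real
      show "ennreal (1 / (- K * ln u) / u) * indicator {a..exp (- 1)} u
          \<le> ennreal (1 / max 1 (- K * ln u) / u) * indicator {0<..1} u"
      proof (cases "u \<in> {a..exp (- 1)}")
        case True
        note * = ln_le[OF True]
        have "1 * 1 \<le> K * - ln u" using * assms by (intro mult_mono) auto
        moreover have "u \<le> 1" using True by (auto intro: order.trans)
        ultimately show ?thesis using * by (simp add: max_def split: split_indicator)
      qed simp
    qed
    finally show ?thesis .
  qed
  show ?thesis
  proof (rule ccontr)
    assume "?I \<noteq> \<infinity>"
    then obtain n where "?I < of_nat n"
      using ennreal_Ex_less_of_nat[of ?I] by (auto simp: less_top)
    with ge[of n] show False by simp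
  qed
qed

context markov_chain
begin

text \<open>Monotonicity turns u < \<open>\<Phi>\<close> n into a lower bound n for the inverse at
  u, which is the bound needed for \<open>w\<close> = 1 / max 1 (ln of the inverse).\<close>

lemma AE_infinite_cut_times_profile:
  fixes \<Phi> :: "real \<Rightarrow> real"
  assumes bij: "bij_betw \<Phi> {0..} {0<..1}"
    and anti: "\<And>a b. 0 \<le> a \<Longrightarrow> a \<le> b \<Longrightarrow> \<Phi> b \<le> \<Phi> a"
    and inf: "(\<integral>\<^sup>+ u. ennreal (1 / (u * max 1 (ln (inv_into {0..} \<Phi> u))))
        \<partial>(restrict_space lborel {0<..1})) = \<infinity>"
    and limsup: "\<And>m. AE w in M. limsup (\<lambda>n. green P (X n w) (X m w) / ennreal (\<Phi> (real n))) < \<infinity>"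
  shows "AE w in M. infinite {n. cut_time (\<lambda>i. X i w) n}"
proof -
  define \<Psi> where "\<Psi> = inv_into {0..} \<Phi>"
  have \<Phi>_range: "0 < \<Phi> t" "\<Phi> t \<le> 1" if "0 \<le> t" for t
    using bij_betwE[OF bij] that by auto
  have \<Psi>: "0 \<le> \<Psi> u" "\<Phi> (\<Psi> u) = u" if "u \<in> {0<..1}" for u
    using bij that unfolding bij_betw_def \<Psi>_def
    by (metis atLeast_iff inv_into_into, metis f_inv_into_f)
  have lt_\<Phi>: "t \<le> \<Psi> u" if "u \<in> {0<..1}" "0 \<le> t" "u < \<Phi> t" for t u
    using anti[of "\<Psi> u" t] \<Psi>[OF that(1)] that by fastforce
  \<comment> \<open>Measurability of the inverse comes from monotonicity, after a change of sign
    because it is decreasing.\<close>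
  have "mono_on {0<..1} (\<lambda>u. - \<Psi> u)"
  proof (rule mono_onI)
    fix u v :: real assume uv: "u \<in> {0<..1}" "v \<in> {0<..1}" "u \<le> v"
    show "- \<Psi> u \<le> - \<Psi> v"
    proof (cases "u = v")
      case False
      then show ?thesis using lt_\<Phi>[of u "\<Psi> v"] \<Psi>[OF uv(2)] uv by simp
    qed simp
  qed
  then have "(\<lambda>u. - (- \<Psi> u)) \<in> borel_measurable (restrict_space borel {0<..1})"
    by (intro borel_measurable_uminus borel_measurable_mono_on_fnc)
  then have [measurable]: "\<Psi> \<in> borel_measurable (restrict_space borel {0<..1})"
    by simp
  define w where "w u = (if u \<in> {0<..1} then 1 / max 1 (ln (\<Psi> u)) else 0)" for u
  have "(\<lambda>u. indicator {0<..1} u *\<^sub>R (1 / max 1 (ln (\<Psi> u)))) \<in> borel_measurable borel"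
    by (subst borel_measurable_restrict_space_iff[symmetric]) (simp, measurable)
  also have "(\<lambda>u. indicator {0<..1} u *\<^sub>R (1 / max 1 (ln (\<Psi> u)))) = w"
    by (auto simp: w_def fun_eq_iff split: split_indicator)
  finally have w_meas: "w \<in> borel_measurable borel" .
  have "AE \<omega> in M. \<forall>m. limsup (\<lambda>n. green P (X n \<omega>) (X m \<omega>) / ennreal (\<Phi> (real n))) < \<infinity>"
    using limsup by (simp add: AE_all_countable)
  \<comment> \<open>There is a single profile here, so \<open>k\<close> is a dummy index.\<close>
  then have decay: "AE \<omega> in M. \<forall>m. \<exists>(k::nat) C n0. \<forall>n\<ge>n0.
      green P (X n \<omega>) (X m \<omega>) \<le> ennreal (real (Suc C) * \<Phi> (real n))"
  proof (rule AE_mp, intro AE_I2 impI allI)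
    fix \<omega> m
    assume "\<forall>m. limsup (\<lambda>n. green P (X n \<omega>) (X m \<omega>) / ennreal (\<Phi> (real n))) < \<infinity>"
    then have "limsup (\<lambda>n. green P (X n \<omega>) (X m \<omega>) / ennreal (\<Phi> (real n))) < top"
      unfolding infinity_ennreal_def by blast
    from ennreal_Ex_less_of_nat[OF this]
    obtain C where C: "limsup (\<lambda>n. green P (X n \<omega>) (X m \<omega>) / ennreal (\<Phi> (real n))) < of_nat C" ..
    obtain n0 where n0: "green P (X n \<omega>) (X m \<omega>) / ennreal (\<Phi> (real n)) < of_nat C" if "n0 \<le> n" for n
      using Limsup_lessD[OF C] unfolding eventually_sequentially by blast
    have "green P (X n \<omega>) (X m \<omega>) \<le> ennreal (real (Suc C) * \<Phi> (real n))" if "n0 \<le> n" for n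
    proof -
      have pos: "0 < \<Phi> (real n)" using \<Phi>_range by simp
      have "green P (X n \<omega>) (X m \<omega>) = green P (X n \<omega>) (X m \<omega>) / ennreal (\<Phi> (real n)) * ennreal (\<Phi> (real n))"
        using pos by (simp add: ennreal_divide_times ennreal_mult_divide_eq)
      also have "\<dots> \<le> of_nat C * ennreal (\<Phi> (real n))"
        using n0[OF that] by (intro mult_right_mono) auto
      also have "\<dots> = ennreal (real C * \<Phi> (real n))"
        using pos by (simp add: ennreal_of_nat_eq_real_of_nat ennreal_mult)
      also have "\<dots> \<le> ennreal (real (Suc C) * \<Phi> (real n))"
        using pos by (intro ennreal_leI mult_right_mono) auto
      finally show ?thesis .
    qed
    then show "\<exists>(k::nat) C n0. \<forall>n\<ge>n0. green P (X n \<omega>) (X m \<omega>) \<le> ennreal (real (Suc C) * \<Phi> (real n))"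
      by blast
  qed
  show ?thesis
  proof (rule AE_infinite_cut_times[where w = "\<lambda>k. w" and \<phi> = "\<lambda>k n. \<Phi> (real n)"])
    show "w \<in> borel_measurable borel" by (rule w_meas)
    show "0 \<le> w u" "w u \<le> 1" for u by (auto simp: w_def)
    show "w u \<le> 1 / max 1 (ln (real n))" if "0 < u" "u < \<Phi> (real n)" for n u
    proof -
      have u: "u \<in> {0<..1}" using that \<Phi>_range[of "real n"] by auto
      have "real n \<le> \<Psi> u" by (rule lt_\<Phi>[OF u _ that(2)]) simp
      then have "max 1 (ln (real n)) \<le> max 1 (ln (\<Psi> u))"
        by (cases "n = 0") (auto intro!: max.coboundedI2 ln_mono)
      then show ?thesis using u by (auto simp: w_def intro!: divide_left_mono)
    qed
    show "(\<lambda>n. \<Phi> (real n)) \<longlonglongrightarrow> 0"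
    proof (rule decreasing_tendsto)
      show "\<forall>\<^sub>F n in sequentially. 0 \<le> \<Phi> (real n)"
        using \<Phi>_range by (auto intro!: always_eventually less_imp_le)
      fix e :: real assume "0 < e"
      \<comment> \<open>A value below \<open>e\<close> that also lies in the range of
        \<open>\<Phi>\<close>, so that it is attained at \<open>\<Psi> v\<close>.\<close>
      define v where "v = min 1 e / 2"
      have v: "v \<in> {0<..1}" "v < e" using \<open>0 < e\<close> by (auto simp: v_def min_def)
      have "\<Phi> (real n) < e" if "nat \<lceil>\<Psi> v\<rceil> \<le> n" for n
      proof -
        have "\<Psi> v \<le> real n" using that by linarith
        then have "\<Phi> (real n) \<le> v" using anti[of "\<Psi> v" "real n"] \<Psi>[OF v(1)] by simp
        with v show ?thesis by simp
      qed
      then show "\<forall>\<^sub>F n in sequentially. \<Phi> (real n) < e"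
        unfolding eventually_sequentially by blast
    qed
    show "0 \<le> \<Phi> (real n)" for n using \<Phi>_range[of "real n"] by simp
    have "(\<integral>\<^sup>+u. ennreal (w u / u) * indicator {0<..1} u \<partial>lborel)
      = (\<integral>\<^sup>+ u. ennreal (1 / (u * max 1 (ln (\<Psi> u)))) \<partial>(restrict_space lborel {0<..1}))"
      by (subst nn_integral_restrict_space)
         (auto intro!: nn_integral_cong simp: w_def mult.commute split: split_indicator)
    then show "(\<integral>\<^sup>+u. ennreal (w u / u) * indicator {0<..1} u \<partial>lborel) = \<infinity>"
      using inf by (simp add: \<Psi>_def)
    show "AE \<omega> in M. \<forall>m. \<exists>(k::nat) C n0. \<forall>n\<ge>n0.
      green P (X n \<omega>) (X m \<omega>) \<le> ennreal (real (Suc C) * \<Phi> (real n))" by (rule decay)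
  qed
qed

text \<open>The random exponent may be lowered to one of the countably many \<open>1 / (k + 1)\<close>.\<close>

lemma AE_infinite_cut_times_polynomial:
  assumes "AE w in M. \<forall>m. decays_polynomially (\<lambda>n. green P (X n w) (X m w))"
  shows "AE w in M. infinite {n. cut_time (\<lambda>i. X i w) n}"
\<comment> \<open>The profile t^(-1/(k+1)) has inverse u^(-(k+1)), whose logarithm is -(k+1) ln
  u.\<close>
proof (rule AE_infinite_cut_times[where
      w = "\<lambda>k u. if u \<in> {0<..1} then 1 / max 1 (- real (Suc k) * ln u) else 0" and
      \<phi> = "\<lambda>k n. real n powr - (1 / real (Suc k))"])
  fix k :: nat and u :: real
  let ?w = "\<lambda>u. if u \<in> {0<..1} then 1 / max 1 (- real (Suc k) * ln u) else 0"
  show "?w \<in> borel_measurable borel" by measurable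
  show "0 \<le> ?w u" "?w u \<le> 1" by auto
  show "?w u \<le> 1 / max 1 (ln (real n))" if u: "0 < u" "u < real n powr - (1 / real (Suc k))" for n
  proof -
    \<comment> \<open>At n = 0 the \<open>powr\<close> term is 0, so no positive \<open>u\<close>
      lies below it.\<close>
    have "0 < n" using u by (cases "n = 0") auto
    have "ln u \<le> ln (real n powr - (1 / real (Suc k)))"
      using u by (intro ln_mono) auto
    also have "\<dots> = - ln (real n) / real (Suc k)"
      using \<open>0 < n\<close> by (simp add: ln_powr)
    finally have "ln (real n) \<le> - real (Suc k) * ln u"
      by (simp add: field_simps)
    then have "max 1 (ln (real n)) \<le> max 1 (- real (Suc k) * ln u)" by (intro max.mono) auto
    then show ?thesis by (auto intro!: divide_left_mono)
  qed
  show "(\<lambda>n. real n powr - (1 / real (Suc k))) \<longlonglongrightarrow> 0"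
    by (intro tendsto_neg_powr filterlim_real_sequentially) simp
  have "(\<integral>\<^sup>+u. ennreal (?w u / u) * indicator {0<..1} u \<partial>lborel)
      = (\<integral>\<^sup>+u. ennreal (1 / max 1 (- real (Suc k) * ln u) / u) * indicator {0<..1} u \<partial>lborel)"
    by (intro nn_integral_cong) (auto split: split_indicator)
  also have "\<dots> = \<infinity>" by (rule nn_integral_inverse_log) simp
  finally show "(\<integral>\<^sup>+u. ennreal (?w u / u) * indicator {0<..1} u \<partial>lborel) = \<infinity>" .
next
  have polynomial: "\<exists>k C n0. \<forall>n\<ge>n0. a n \<le> ennreal (real (Suc C) * real n powr - (1 / real (Suc k)))"
    if decay: "decays_polynomially a" for a
  proof -
    obtain c :: real and N where c: "0 < c" "\<And>n. N \<le> n \<Longrightarrow> a n \<le> ennreal (real n powr - c)"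
      using decay by (auto simp: decays_polynomially_def)
    obtain k where k: "1 / real (Suc k) < c"
      using nat_approx_posE[OF c(1)] by auto
    \<comment> \<open>The base must be at least 1 for the power to increase with its exponent, hence
      the bound \<open>max 1 N\<close>.\<close>
    have "a n \<le> ennreal (real (Suc 0) * real n powr - (1 / real (Suc k)))" if "max 1 N \<le> n" for n
    proof -
      have "real n powr - c \<le> real n powr - (1 / real (Suc k))"
        using that k by (intro powr_mono) auto
      then show ?thesis using c(2)[of n] that by (auto intro: order.trans ennreal_leI)
    qed
    then show ?thesis by blast
  qed
  show "AE \<omega> in M. \<forall>m. \<exists>k C n0. \<forall>n\<ge>n0.
      green P (X n \<omega>) (X m \<omega>) \<le> ennreal (real (Suc C) * real n powr - (1 / real (Suc k)))"
    by (rule AE_mp[OF assms], intro AE_I2 impI allI, rule polynomial) blast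
qed simp

end

theorem theorem1p1:
  fixes M :: "'w measure" and P :: "'a::countable \<Rightarrow> 'a \<Rightarrow> real"
    and x :: 'a and X :: "nat \<Rightarrow> 'w \<Rightarrow> 'a"
  assumes "stochastic_kernel P"
    and "markov_trajectory M P x X"
  shows "(\<forall>\<Phi> :: real \<Rightarrow> real.
            (bij_betw \<Phi> {0..} {0<..1} \<and>
             (\<forall>a b. 0 \<le> a \<longrightarrow> a \<le> b \<longrightarrow> \<Phi> b \<le> \<Phi> a) \<and>
             (\<integral>\<^sup>+ u. ennreal (1 / (u * max 1 (ln (inv_into {0..} \<Phi> u))))
                 \<partial>(restrict_space lborel {0<..1})) = \<infinity> \<and>
             (\<forall>m. AE w in M. limsup (\<lambda>n. green P (X n w) (X m w) / ennreal (\<Phi> (real n))) < \<infinity>))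
            \<longrightarrow> (AE w in M. infinite {n. cut_time (\<lambda>i. X i w) n}))
       \<and> ((AE w in M. \<forall>m. decays_polynomially (\<lambda>n. green P (X n w) (X m w)))
            \<longrightarrow> (AE w in M. infinite {n. cut_time (\<lambda>i. X i w) n}))"
proof -
  interpret markov_chain M P x X
    by unfold_locales (fact assms)+
  show ?thesis
    using AE_infinite_cut_times_profile AE_infinite_cut_times_polynomial by blast
qed

end
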